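(* Let $(Q,\cdot)$ be a quasigroup. 1. If there are permutations $\alpha_1,\dots,\alpha_8$ of $Q$ such that $$\alpha_1(\alpha_2 x\cdot\alpha_3 y)\cdot\alpha_4(\alpha_5 u\cdot\alpha_6 v)=\alpha_7(x\cdot u)\cdot\alpha_8(y\cdot v)\quad\text{for all }x,y,u,v\in Q$$ (i.e. $(Q,\cdot)$ is permutation medial), then $(Q,\cdot)$ is an abelian group isotope. 2. If there are permutations $\alpha_1,\dots,\alpha_8$ of $Q$ such that $$\alpha_1(\alpha_2 x\cdot\alpha_3 y)\cdot\alpha_4(\alpha_5 u\cdot\alpha_6 v)=\alpha_7(v\cdot y)\cdot\alpha_8(u\cdot x)\quad\text{for all }x,y,u,v\in Q$$ (i.e. $(Q,\cdot)$ is permutation paramedial), then $(Q,\cdot)$ is an abelian group isotope.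
   Context: A quasigroup $(Q,\cdot)$ is a non-empty set $Q$ with a binary operation such that for all $a,b\in Q$ the equations $x\cdot a=b$ and $a\cdot y=b$ each have a unique solution. It is an abelian group isotope if there are an abelian group $(Q,+)$ and permutations $\mu_1,\mu_2,\mu_3$ of $Q$ such that $x\cdot y=\mu_3^{-1}(\mu_1x+\mu_2y)$ for all $x,y\in Q$. *)

theory Defs
  imports "HOL-Algebra.Group"
begin

locale quasigroup =
  fixes Q :: "'a set" and mult :: "'a \<Rightarrow> 'a \<Rightarrow> 'a"  (infixl "\<cdot>" 70)
  assumes nonempty: "Q \<noteq> {}"
    and closed: "\<lbrakk>x \<in> Q; y \<in> Q\<rbrakk> \<Longrightarrow> x \<cdot> y \<in> Q"
    and unique_left_solution: "\<lbrakk>a \<in> Q; b \<in> Q\<rbrakk> \<Longrightarrow> \<exists>!x. x \<in> Q \<and> x \<cdot> a = b"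
    and unique_right_solution: "\<lbrakk>a \<in> Q; b \<in> Q\<rbrakk> \<Longrightarrow> \<exists>!y. y \<in> Q \<and> a \<cdot> y = b"

abbreviation permutation_of :: "'a set \<Rightarrow> ('a \<Rightarrow> 'a) \<Rightarrow> bool"
  where "permutation_of Q \<pi> \<equiv> bij_betw \<pi> Q Q"

context
  fixes Q :: "'a set" and mult :: "'a \<Rightarrow> 'a \<Rightarrow> 'a"  (infixl "\<cdot>" 70)
begin

text \<open>The abelian group is written multiplicatively, as everywhere in the group library.\<close>

definition abelian_group_isotope :: bool
  where "abelian_group_isotope \<longleftrightarrow>
    (\<exists>G :: 'a monoid. comm_group G \<and> carrier G = Q \<and>
      (\<exists>\<mu>\<^sub>1 \<mu>\<^sub>2 \<mu>\<^sub>3.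
        permutation_of Q \<mu>\<^sub>1 \<and> permutation_of Q \<mu>\<^sub>2 \<and> permutation_of Q \<mu>\<^sub>3 \<and>
        (\<forall>x\<in>Q. \<forall>y\<in>Q. x \<cdot> y = inv_into Q \<mu>\<^sub>3 (\<mu>\<^sub>1 x \<otimes>\<^bsub>G\<^esub> \<mu>\<^sub>2 y))))"

definition permutation_medial :: bool
  where "permutation_medial \<longleftrightarrow>
    (\<exists>\<alpha>\<^sub>1 \<alpha>\<^sub>2 \<alpha>\<^sub>3 \<alpha>\<^sub>4 \<alpha>\<^sub>5 \<alpha>\<^sub>6 \<alpha>\<^sub>7 \<alpha>\<^sub>8.
      permutation_of Q \<alpha>\<^sub>1 \<and> permutation_of Q \<alpha>\<^sub>2 \<and> permutation_of Q \<alpha>\<^sub>3 \<and> permutation_of Q \<alpha>\<^sub>4 \<and>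
      permutation_of Q \<alpha>\<^sub>5 \<and> permutation_of Q \<alpha>\<^sub>6 \<and> permutation_of Q \<alpha>\<^sub>7 \<and> permutation_of Q \<alpha>\<^sub>8 \<and>
      (\<forall>x\<in>Q. \<forall>y\<in>Q. \<forall>u\<in>Q. \<forall>v\<in>Q.
        \<alpha>\<^sub>1 (\<alpha>\<^sub>2 x \<cdot> \<alpha>\<^sub>3 y) \<cdot> \<alpha>\<^sub>4 (\<alpha>\<^sub>5 u \<cdot> \<alpha>\<^sub>6 v) = \<alpha>\<^sub>7 (x \<cdot> u) \<cdot> \<alpha>\<^sub>8 (y \<cdot> v)))"

definition permutation_paramedial :: bool
  where "permutation_paramedial \<longleftrightarrow>
    (\<exists>\<alpha>\<^sub>1 \<alpha>\<^sub>2 \<alpha>\<^sub>3 \<alpha>\<^sub>4 \<alpha>\<^sub>5 \<alpha>\<^sub>6 \<alpha>\<^sub>7 \<alpha>\<^sub>8.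
      permutation_of Q \<alpha>\<^sub>1 \<and> permutation_of Q \<alpha>\<^sub>2 \<and> permutation_of Q \<alpha>\<^sub>3 \<and> permutation_of Q \<alpha>\<^sub>4 \<and>
      permutation_of Q \<alpha>\<^sub>5 \<and> permutation_of Q \<alpha>\<^sub>6 \<and> permutation_of Q \<alpha>\<^sub>7 \<and> permutation_of Q \<alpha>\<^sub>8 \<and>
      (\<forall>x\<in>Q. \<forall>y\<in>Q. \<forall>u\<in>Q. \<forall>v\<in>Q.
        \<alpha>\<^sub>1 (\<alpha>\<^sub>2 x \<cdot> \<alpha>\<^sub>3 y) \<cdot> \<alpha>\<^sub>4 (\<alpha>\<^sub>5 u \<cdot> \<alpha>\<^sub>6 v) = \<alpha>\<^sub>7 (v \<cdot> y) \<cdot> \<alpha>\<^sub>8 (u \<cdot> x)))"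

end

end

theory Submission
  imports Defs
begin

text \<open>
  Both laws are instances of the generalized bisymmetry equation
  \<open>A(B(x,y),C(u,v)) = D(E(x,u),F(y,v))\<close>,
  where \<open>A\<close> is the given multiplication and \<open>B\<close>, \<open>C\<close>, \<open>E\<close>, \<open>F\<close> are isotopes of it or of its
  opposite; the paramedial law takes this shape once the two factors on its right-hand side are
  exchanged, so that \<open>D\<close> is the opposite multiplication.

  To solve that equation, fix a base point \<open>o\<close>, put \<open>b = B(o,o)\<close>, \<open>c = C(o,o)\<close>, and
  pass to the loop \<open>p + q\<close> given by \<open>A(p,q) = A(p,c) + A(b,q)\<close>, whose neutral element is \<open>A(b,c)\<close>.
  Let \<open>f\<close>, \<open>g\<close>, \<open>h\<close>, \<open>k\<close> be the four functions of one variable obtained from the common value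
  of the two sides by setting all variables but \<open>x\<close>, \<open>y\<close>, \<open>u\<close>, \<open>v\<close>, respectively, to
  \<open>o\<close>. They are onto. For \<open>y = u = o\<close> the equation reads
  \<open>f x + k v = D(E(x,o),F(o,v))\<close>. Every value \<open>E(x,u)\<close> has the form \<open>E(x',o)\<close>, and then
  \<open>f x' = D(E(x,u),F(o,o)) = f x + h u\<close>, by the equation for \<open>y = v = o\<close>; in the same way
  \<open>F(y,v) = F(o,v')\<close> with \<open>k v' = g y + k v\<close>. So the right-hand side is
  \<open>(f x + h u) + (g y + k v)\<close>. Taking \<open>u = v = o\<close> or \<open>x = y = o\<close> evaluates \<open>B\<close> and \<open>C\<close>,
  and the left-hand side becomes \<open>(f x + g y) + (h u + k v)\<close>. Hence the loop is medial, and a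
  medial loop is an abelian group (lemma \<open>comm_group_of_medial_loop\<close>).
\<close>

section \<open>Quasigroups and their isotopes\<close>

lemma quasigroup_iff_translations:
  "quasigroup Q A \<longleftrightarrow>
    Q \<noteq> {} \<and> (\<forall>a\<in>Q. bij_betw (\<lambda>x. A x a) Q Q) \<and> (\<forall>a\<in>Q. bij_betw (A a) Q Q)"
proof
  assume "quasigroup Q A"
  then interpret quasigroup Q A .
  have "bij_betw (\<lambda>x. A x a) Q Q" if a: "a \<in> Q" for a
  proof (rule bij_betw_imageI)
    show "inj_on (\<lambda>x. A x a) Q"
      using unique_left_solution[OF a] closed a by (intro inj_onI) metis
    show "(\<lambda>x. A x a) ` Q = Q"
    proof
      show "(\<lambda>x. A x a) ` Q \<subseteq> Q"
        using closed a by blast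
      show "Q \<subseteq> (\<lambda>x. A x a) ` Q"
        using unique_left_solution[OF a] by (intro subsetI) (metis image_eqI)
    qed
  qed
  moreover have "bij_betw (A a) Q Q" if a: "a \<in> Q" for a
  proof (rule bij_betw_imageI)
    show "inj_on (A a) Q"
      using unique_right_solution[OF a] closed a by (intro inj_onI) metis
    show "A a ` Q = Q"
    proof
      show "A a ` Q \<subseteq> Q"
        using closed a by blast
      show "Q \<subseteq> A a ` Q"
        using unique_right_solution[OF a] by (intro subsetI) (metis image_eqI)
    qed
  qed
  ultimately show "Q \<noteq> {} \<and> (\<forall>a\<in>Q. bij_betw (\<lambda>x. A x a) Q Q) \<and> (\<forall>a\<in>Q. bij_betw (A a) Q Q)"
    using nonempty by blast
next
  assume *: "Q \<noteq> {} \<and> (\<forall>a\<in>Q. bij_betw (\<lambda>x. A x a) Q Q) \<and> (\<forall>a\<in>Q. bij_betw (A a) Q Q)"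
  show "quasigroup Q A"
  proof
    show "Q \<noteq> {}"
      using * by blast
    show "A x y \<in> Q" if "x \<in> Q" "y \<in> Q" for x y
      using * that bij_betwE by blast
    show "\<exists>!x. x \<in> Q \<and> A x a = b" if "a \<in> Q" "b \<in> Q" for a b
    proof -
      have "bij_betw (\<lambda>x. A x a) Q Q"
        using * that by blast
      then have "b \<in> (\<lambda>x. A x a) ` Q" "inj_on (\<lambda>x. A x a) Q"
        using that by (simp_all add: bij_betw_def)
      then show ?thesis
        by (auto dest: inj_onD)
    qed
    show "\<exists>!y. y \<in> Q \<and> A a y = b" if "a \<in> Q" "b \<in> Q" for a b
    proof -
      have "bij_betw (A a) Q Q"
        using * that by blast
      then have "b \<in> A a ` Q" "inj_on (A a) Q"
        using that by (simp_all add: bij_betw_def)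
      then show ?thesis
        by (auto dest: inj_onD)
    qed
  qed
qed

lemma quasigroup_opposite:
  "quasigroup Q A \<Longrightarrow> quasigroup Q (\<lambda>x y. A y x)"
  by (simp add: quasigroup_iff_translations)

lemma quasigroup_isotope:
  assumes "quasigroup Q A"
    and "permutation_of Q \<alpha>" "permutation_of Q \<beta>" "permutation_of Q \<gamma>"
  shows "quasigroup Q (\<lambda>x y. \<gamma> (A (\<alpha> x) (\<beta> y)))"
proof -
  have "bij_betw (\<lambda>x. \<gamma> (A (\<alpha> x) (\<beta> a))) Q Q" if "a \<in> Q" for a
  proof -
    have "bij_betw (\<lambda>x. A x (\<beta> a)) Q Q"
      using assms(1) bij_betwE[OF assms(3)] that by (simp add: quasigroup_iff_translations)
    then have "bij_betw (\<gamma> \<circ> ((\<lambda>x. A x (\<beta> a)) \<circ> \<alpha>)) Q Q"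
      using assms(2,4) by (intro bij_betw_trans)
    then show ?thesis
      by (simp add: comp_def)
  qed
  moreover have "bij_betw (\<lambda>y. \<gamma> (A (\<alpha> a) (\<beta> y))) Q Q" if "a \<in> Q" for a
  proof -
    have "bij_betw (A (\<alpha> a)) Q Q"
      using assms(1) bij_betwE[OF assms(2)] that by (simp add: quasigroup_iff_translations)
    then have "bij_betw (\<gamma> \<circ> (A (\<alpha> a) \<circ> \<beta>)) Q Q"
      using assms(3,4) by (intro bij_betw_trans)
    then show ?thesis
      by (simp add: comp_def)
  qed
  ultimately show ?thesis
    using assms(1) by (simp add: quasigroup_iff_translations)
qed

section \<open>The generalized bisymmetry equation\<close>

lemma comm_group_of_medial_loop:
  fixes G (structure)
  assumes closed: "\<And>x y. \<lbrakk>x \<in> carrier G; y \<in> carrier G\<rbrakk> \<Longrightarrow> x \<otimes> y \<in> carrier G"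
    and one: "\<one> \<in> carrier G"
    and l_one: "\<And>x. x \<in> carrier G \<Longrightarrow> \<one> \<otimes> x = x"
    and r_one: "\<And>x. x \<in> carrier G \<Longrightarrow> x \<otimes> \<one> = x"
    and inverse: "\<And>x. x \<in> carrier G \<Longrightarrow> \<exists>y\<in>carrier G. y \<otimes> x = \<one>"
    and medial: "\<And>x y u v. \<lbrakk>x \<in> carrier G; y \<in> carrier G; u \<in> carrier G; v \<in> carrier G\<rbrakk>
      \<Longrightarrow> (x \<otimes> y) \<otimes> (u \<otimes> v) = (x \<otimes> u) \<otimes> (y \<otimes> v)"
  shows "comm_group G"
proof (rule comm_groupI)
  show "x \<otimes> y \<otimes> z = x \<otimes> (y \<otimes> z)"
    if "x \<in> carrier G" "y \<in> carrier G" "z \<in> carrier G" for x y z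
    using medial[of x y \<one> z] that one by (simp add: l_one r_one)
  show "x \<otimes> y = y \<otimes> x" if "x \<in> carrier G" "y \<in> carrier G" for x y
    using medial[of \<one> x y \<one>] that one by (simp add: l_one r_one)
qed (use closed one l_one inverse in auto)

text \<open>Nothing is required of \<open>D\<close>: the equation determines it on all of \<open>Q \<times> Q\<close>, because
  \<open>E\<close> and \<open>F\<close> are onto.\<close>

lemma abelian_group_isotope_of_generalized_bisymmetry:
  fixes Q :: "'a set"
  assumes A: "quasigroup Q A" and B: "quasigroup Q B" and C: "quasigroup Q C"
    and E: "quasigroup Q E" and F: "quasigroup Q F"
    and eq: "\<And>x y u v. \<lbrakk>x \<in> Q; y \<in> Q; u \<in> Q; v \<in> Q\<rbrakk>
      \<Longrightarrow> A (B x y) (C u v) = D (E x u) (F y v)"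
  shows "abelian_group_isotope Q A"
proof -
  interpret A: quasigroup Q A by (rule A)
  interpret B: quasigroup Q B by (rule B)
  interpret C: quasigroup Q C by (rule C)
  interpret E: quasigroup Q E by (rule E)
  interpret F: quasigroup Q F by (rule F)
  \<comment> \<open>The variable is primed because \<open>o\<close> is composition of functions.\<close>
  obtain o' where o: "o' \<in> Q"
    using A.nonempty by blast
  define b where "b = B o' o'"
  define c where "c = C o' o'"
  define z where "z = A b c"
  define R where "R p = A p c" for p
  define L where "L q = A b q" for q
  define plus where "plus p q = A (inv_into Q R p) (inv_into Q L q)" for p q
  have b: "b \<in> Q" and c: "c \<in> Q" and z: "z \<in> Q"
    using o by (simp_all add: b_def c_def z_def A.closed B.closed C.closed)
  have R: "bij_betw R Q Q" and L: "bij_betw L Q Q"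
    using A b c by (simp_all add: R_def[abs_def] L_def[abs_def] quasigroup_iff_translations)
  have plus: "plus (R p) (L q) = A p q" if "p \<in> Q" "q \<in> Q" for p q
    using that by (simp add: plus_def bij_betw_inv_into_left[OF R] bij_betw_inv_into_left[OF L])
  have R_onto: "\<exists>q\<in>Q. p = R q" and L_onto: "\<exists>q\<in>Q. p = L q" if "p \<in> Q" for p
    using that R L by (auto simp: bij_betw_def)
  have Rb: "R b = z" and Lc: "L c = z"
    by (simp_all add: R_def L_def z_def)
  have r_zero: "plus p z = p" if "p \<in> Q" for p
    using R_onto[OF that] plus[OF _ c] by (auto simp: Lc R_def)
  have l_zero: "plus z p = p" if "p \<in> Q" for p
    using L_onto[OF that] plus[OF b] by (auto simp: Rb L_def)
  have plus_closed: "plus p q \<in> Q" if "p \<in> Q" "q \<in> Q" for p q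
    using R_onto[OF that(1)] L_onto[OF that(2)] plus A.closed by auto
  have inverse: "\<exists>q\<in>Q. plus q p = z" if p: "p \<in> Q" for p
  proof -
    obtain r where r: "r \<in> Q" "p = L r"
      using L_onto[OF p] by blast
    obtain s where "s \<in> Q" "A s r = z"
      using A.unique_left_solution[OF r(1) z] by blast
    then show ?thesis
      using r plus R bij_betwE by metis
  qed
  define f where "f x = R (B x o')" for x
  define g where "g y = R (B o' y)" for y
  define h where "h u = L (C u o')" for u
  define k where "k v = L (C o' v)" for v
  have in_Q: "f x \<in> Q" "g x \<in> Q" "h x \<in> Q" "k x \<in> Q" if "x \<in> Q" for x
    using that o b c
    by (auto simp: f_def g_def h_def k_def R_def L_def intro!: A.closed B.closed C.closed)
  have f_onto: "\<exists>x\<in>Q. p = f x" if "p \<in> Q" for p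
    using R_onto[OF that] B.unique_left_solution[OF o] unfolding f_def by metis
  have g_onto: "\<exists>y\<in>Q. p = g y" if "p \<in> Q" for p
    using R_onto[OF that] B.unique_right_solution[OF o] unfolding g_def by metis
  have h_onto: "\<exists>u\<in>Q. p = h u" if "p \<in> Q" for p
    using L_onto[OF that] C.unique_left_solution[OF o] unfolding h_def by metis
  have k_onto: "\<exists>v\<in>Q. p = k v" if "p \<in> Q" for p
    using L_onto[OF that] C.unique_right_solution[OF o] unfolding k_def by metis
  have value_at_o: "f o' = z" "g o' = z" "h o' = z" "k o' = z"
    by (simp_all add: f_def g_def h_def k_def Rb Lc flip: b_def c_def)
  have D_eq: "D (E x u) (F y v) = plus (R (B x y)) (L (C u v))"
    if "x \<in> Q" "y \<in> Q" "u \<in> Q" "v \<in> Q" for x y u v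
    using that by (simp add: eq[symmetric] plus B.closed C.closed)
  have RBo: "R (B x o') = f x" "R (B o' x) = g x" "L (C x o') = h x" "L (C o' x) = k x" for x
    by (simp_all add: f_def g_def h_def k_def)
  have D_E: "D (E x u) (F o' o') = plus (f x) (h u)" if "x \<in> Q" "u \<in> Q" for x u
    using D_eq[of x o' u o'] that o by (simp add: RBo)
  have D_F: "D (E o' o') (F y v) = plus (g y) (k v)" if "y \<in> Q" "v \<in> Q" for y v
    using D_eq[of o' y o' v] that o by (simp add: RBo)
  have RB: "R (B x y) = plus (f x) (g y)" if xy: "x \<in> Q" "y \<in> Q" for x y
  proof -
    \<comment> \<open>Moving \<open>F y o'\<close> into the row \<open>F o'\<close> reduces to the case of \<open>x\<close> and \<open>v\<close> alone.\<close>
    obtain v where v: "v \<in> Q" "F o' v = F y o'"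
      using F.unique_right_solution[OF o F.closed[OF xy(2) o]] by blast
    have "plus (R (B x y)) z = D (E x o') (F y o')"
      using D_eq[of x y o' o'] xy o by (simp add: RBo value_at_o)
    also have "\<dots> = plus (f x) (k v)"
      using D_eq[of x o' o' v] xy o v by (simp add: RBo)
    also have "k v = g y"
      using D_F[of y o'] D_F[of o' v] xy o v in_Q by (simp add: value_at_o r_zero l_zero)
    finally show ?thesis
      using xy b c A.closed B.closed by (simp add: r_zero R_def)
  qed
  have LC: "L (C u v) = plus (h u) (k v)" if uv: "u \<in> Q" "v \<in> Q" for u v
  proof -
    \<comment> \<open>Moving \<open>E o' u\<close> into the column of \<open>o'\<close> reduces to the case of \<open>x\<close> and \<open>v\<close> alone.\<close>
    obtain x where x: "x \<in> Q" "E x o' = E o' u"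
      using E.unique_left_solution[OF o E.closed[OF o uv(1)]] by blast
    have "plus z (L (C u v)) = D (E o' u) (F o' v)"
      using D_eq[of o' o' u v] uv o by (simp add: RBo value_at_o)
    also have "\<dots> = plus (f x) (k v)"
      using D_eq[of x o' o' v] uv o x by (simp add: RBo)
    also have "f x = h u"
      using D_E[of o' u] D_E[of x o'] uv o x in_Q by (simp add: value_at_o r_zero l_zero)
    finally show ?thesis
      using uv b c A.closed C.closed by (simp add: l_zero L_def)
  qed
  have medial: "plus (plus p q) (plus r s) = plus (plus p r) (plus q s)"
    if pqrs: "p \<in> Q" "q \<in> Q" "r \<in> Q" "s \<in> Q" for p q r s
  proof -
    obtain x y u v where xyuv: "x \<in> Q" "y \<in> Q" "u \<in> Q" "v \<in> Q"
      and pqrs_eq: "p = f x" "q = g y" "r = h u" "s = k v"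
      using f_onto[OF pqrs(1)] g_onto[OF pqrs(2)] h_onto[OF pqrs(3)] k_onto[OF pqrs(4)] by blast
    obtain x' where x': "x' \<in> Q" "E x' o' = E x u"
      using E.unique_left_solution[OF o E.closed[OF xyuv(1,3)]] by blast
    obtain v' where v': "v' \<in> Q" "F o' v' = F y v"
      using F.unique_right_solution[OF o F.closed[OF xyuv(2,4)]] by blast
    have "f x' = plus (f x) (h u)"
      using D_E[of x' o'] D_E[of x u] x' xyuv o in_Q by (simp add: value_at_o r_zero)
    moreover have "k v' = plus (g y) (k v)"
      using D_F[of o' v'] D_F[of y v] v' xyuv o in_Q by (simp add: value_at_o l_zero)
    moreover have "D (E x u) (F y v) = plus (f x') (k v')"
      using D_eq[of x' o' o' v'] x' v' o by (simp add: RBo)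
    ultimately show ?thesis
      using D_eq[of x y u v] xyuv by (simp add: pqrs_eq RB LC)
  qed
  define G where "G = \<lparr>carrier = Q, mult = plus, one = z\<rparr>"
  have "comm_group G"
    by (rule comm_group_of_medial_loop)
      (auto simp: G_def z plus_closed l_zero r_zero inverse medial)
  moreover have "\<forall>x\<in>Q. \<forall>y\<in>Q. A x y = inv_into Q (\<lambda>p. p) (R x \<otimes>\<^bsub>G\<^esub> L y)"
    using A.closed by (auto simp: G_def plus inv_into_f_f[of "\<lambda>p. p" Q, simplified])
  moreover have "carrier G = Q" "permutation_of Q (\<lambda>p. p)"
    by (simp_all add: G_def bij_betw_def)
  ultimately show ?thesis
    unfolding abelian_group_isotope_def using R L by blast
qed

section \<open>Permutation medial and paramedial quasigroups\<close>

lemma permutation_medial_imp_abelian_group_isotope: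
  assumes A: "quasigroup Q A" and "permutation_medial Q A"
  shows "abelian_group_isotope Q A"
proof -
  obtain \<alpha>1 \<alpha>2 \<alpha>3 \<alpha>4 \<alpha>5 \<alpha>6 \<alpha>7 \<alpha>8 where
    eq: "\<forall>x\<in>Q. \<forall>y\<in>Q. \<forall>u\<in>Q. \<forall>v\<in>Q.
      A (\<alpha>1 (A (\<alpha>2 x) (\<alpha>3 y))) (\<alpha>4 (A (\<alpha>5 u) (\<alpha>6 v))) = A (\<alpha>7 (A x u)) (\<alpha>8 (A y v))"
    and perm: "permutation_of Q \<alpha>1" "permutation_of Q \<alpha>2" "permutation_of Q \<alpha>3" "permutation_of Q \<alpha>4"
      "permutation_of Q \<alpha>5" "permutation_of Q \<alpha>6" "permutation_of Q \<alpha>7" "permutation_of Q \<alpha>8"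
    using assms(2) unfolding permutation_medial_def by (elim exE conjE) (rule that)
  note isotope = quasigroup_isotope[OF A]
  have id: "permutation_of Q (\<lambda>x. x)"
    by (simp add: bij_betw_def)
  show ?thesis
    by (rule abelian_group_isotope_of_generalized_bisymmetry[where D = A, OF A
          isotope[OF perm(2,3,1)] isotope[OF perm(5,6,4)]
          isotope[OF id id perm(7)] isotope[OF id id perm(8)]]) (use eq in blast)
qed

lemma permutation_paramedial_imp_abelian_group_isotope:
  assumes A: "quasigroup Q A" and "permutation_paramedial Q A"
  shows "abelian_group_isotope Q A"
proof -
  obtain \<alpha>1 \<alpha>2 \<alpha>3 \<alpha>4 \<alpha>5 \<alpha>6 \<alpha>7 \<alpha>8 where
    eq: "\<forall>x\<in>Q. \<forall>y\<in>Q. \<forall>u\<in>Q. \<forall>v\<in>Q.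
      A (\<alpha>1 (A (\<alpha>2 x) (\<alpha>3 y))) (\<alpha>4 (A (\<alpha>5 u) (\<alpha>6 v))) = A (\<alpha>7 (A v y)) (\<alpha>8 (A u x))"
    and perm: "permutation_of Q \<alpha>1" "permutation_of Q \<alpha>2" "permutation_of Q \<alpha>3" "permutation_of Q \<alpha>4"
      "permutation_of Q \<alpha>5" "permutation_of Q \<alpha>6" "permutation_of Q \<alpha>7" "permutation_of Q \<alpha>8"
    using assms(2) unfolding permutation_paramedial_def by (elim exE conjE) (rule that)
  note isotope = quasigroup_isotope[OF A]
    and opposite_isotope = quasigroup_isotope[OF quasigroup_opposite[OF A]]
  have id: "permutation_of Q (\<lambda>x. x)"
    by (simp add: bij_betw_def)
  show ?thesis
    by (rule abelian_group_isotope_of_generalized_bisymmetry[where D = "\<lambda>x y. A y x", OF A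
          isotope[OF perm(2,3,1)] isotope[OF perm(5,6,4)]
          opposite_isotope[OF id id perm(8)] opposite_isotope[OF id id perm(7)]]) (use eq in blast)
qed

theorem theorem2p62:
  fixes Q :: "'a set" and mult :: "'a \<Rightarrow> 'a \<Rightarrow> 'a"
  assumes "quasigroup Q mult"
  shows "(permutation_medial Q mult \<longrightarrow> abelian_group_isotope Q mult) \<and>
         (permutation_paramedial Q mult \<longrightarrow> abelian_group_isotope Q mult)"
  using assms permutation_medial_imp_abelian_group_isotope
    permutation_paramedial_imp_abelian_group_isotope by blast

end
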